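(* Let $\Gamma=S^1$ be the unit circle in $\mathbb R^2$ and let $\Lambda=\{(e^{t}\cos t,\ e^{t}\sin t): t\le 0\}\subset\mathbb R^2$. Then $(\Gamma,\Lambda)$ is a Heisenberg uniqueness pair.
   Context: For a curve $\Gamma\subset\mathbb R^2$ (a finite disjoint union of smooth curves), $X(\Gamma)$ denotes the space of all finite complex-valued Borel measures $\mu$ on $\mathbb R^2$ that are supported on $\Gamma$ and absolutely continuous with respect to the arc length measure on $\Gamma$. The Fourier transform of $\mu$ is $\hat\mu(\xi,\eta)=\int_\Gamma e^{-i\pi(x\xi+y\eta)}\,d\mu(x,y)$ for $(\xi,\eta)\in\mathbb R^2$. For a set $\Lambda\subset\mathbb R^2$, the pair $(\Gamma,\Lambda)$ is a Heisenberg uniqueness pair (HUP) if every $\mu\in X(\Gamma)$ with $\hat\mu(\xi,\eta)=0$ for all $(\xi,\eta)\in\Lambda$ satisfies $\mu=0$. *)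

theory Defs
  imports "HOL-Analysis.Analysis"
begin

section \<open>Smooth curves and arc length\<close>

text \<open>
  A regular injective \<open>C\<^sup>\<infinity>\<close> parametrization on a nondegenerate interval; \<open>D k\<close> is the
  \<open>k\<close>-th derivative, one-sided at end points of \<open>I\<close> that belong to \<open>I\<close>.  A closed curve is
  parametrized on a half-open interval.
\<close>

definition smooth_parametrization :: "real set \<Rightarrow> (real \<Rightarrow> real \<times> real) \<Rightarrow> bool" where
  "smooth_parametrization I \<gamma> \<longleftrightarrow>
     is_interval I \<and> interior I \<noteq> {} \<and> inj_on \<gamma> I \<and>
     (\<exists>D :: nat \<Rightarrow> real \<Rightarrow> real \<times> real.
        D 0 = \<gamma> \<and>
        (\<forall>k. \<forall>t\<in>I. (D k has_vector_derivative D (Suc k) t) (at t within I)) \<and>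
        (\<forall>t\<in>I. D 1 t \<noteq> 0))"

definition curve_parametrization ::
  "(real \<times> real) set \<Rightarrow> nat \<Rightarrow> (nat \<Rightarrow> real set) \<Rightarrow> (nat \<Rightarrow> real \<Rightarrow> real \<times> real) \<Rightarrow> bool" where
  "curve_parametrization \<Gamma> n I \<gamma> \<longleftrightarrow>
     (\<forall>i<n. smooth_parametrization (I i) (\<gamma> i)) \<and>
     disjoint_family_on (\<lambda>i. \<gamma> i ` I i) {..<n} \<and>
     \<Gamma> = (\<Union>i<n. \<gamma> i ` I i)"

definition is_curve :: "(real \<times> real) set \<Rightarrow> bool" where
  "is_curve \<Gamma> \<longleftrightarrow> (\<exists>n I \<gamma>. curve_parametrization \<Gamma> n I \<gamma>)"

definition parametrized_arc_length ::
  "nat \<Rightarrow> (nat \<Rightarrow> real set) \<Rightarrow> (nat \<Rightarrow> real \<Rightarrow> real \<times> real) \<Rightarrow> (real \<times> real) measure" where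
  "parametrized_arc_length n I \<gamma> =
     measure_of UNIV (sets borel)
       (\<lambda>A. \<Sum>i<n. \<integral>\<^sup>+ t\<in>I i. ennreal (norm (vector_derivative (\<gamma> i) (at t within I i)))
                              * indicator A (\<gamma> i t) \<partial>lborel)"

text \<open>
  Arc length does not depend on the parametrization, so the choice below is immaterial.  It is
  meaningful only if \<open>is_curve \<Gamma>\<close>.
\<close>

definition arc_length_measure :: "(real \<times> real) set \<Rightarrow> (real \<times> real) measure" where
  "arc_length_measure \<Gamma> =
     (SOME \<sigma>. \<exists>n I \<gamma>. curve_parametrization \<Gamma> n I \<gamma> \<and> \<sigma> = parametrized_arc_length n I \<gamma>)"


section \<open>Complex measures\<close>

text \<open>
  A finite complex Borel measure is a countably additive complex-valued set function on the
  Borel sets.  Its values on other sets are irrelevant.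
\<close>

definition complex_borel_measure :: "('a::topological_space set \<Rightarrow> complex) \<Rightarrow> bool" where
  "complex_borel_measure \<mu> \<longleftrightarrow>
     \<mu> {} = 0 \<and>
     (\<forall>A :: nat \<Rightarrow> 'a set. range A \<subseteq> sets borel \<longrightarrow> disjoint_family A \<longrightarrow>
        (\<lambda>i. \<mu> (A i)) sums \<mu> (\<Union>i. A i))"

text \<open>
  The positive part \<open>\<nu>\<^sup>+\<close> in the Jordan decomposition of a signed measure \<open>\<nu>\<close>; the negative part
  is the positive part of \<open>-\<nu>\<close>.  Note that \<^const>\<open>ennreal\<close> sends negative numbers to \<open>0\<close>.
\<close>

definition positive_variation :: "('a::topological_space set \<Rightarrow> real) \<Rightarrow> 'a measure" where
  "positive_variation \<nu> =
     measure_of UNIV (sets borel)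
       (\<lambda>A. SUP B \<in> {B \<in> sets borel. B \<subseteq> A}. ennreal (\<nu> B))"

definition complex_measure_integral ::
  "('a::topological_space set \<Rightarrow> complex) \<Rightarrow> ('a \<Rightarrow> complex) \<Rightarrow> complex" where
  "complex_measure_integral \<mu> f =
     (integral\<^sup>L (positive_variation (\<lambda>A. Re (\<mu> A))) f
        - integral\<^sup>L (positive_variation (\<lambda>A. - Re (\<mu> A))) f)
     + \<i> * (integral\<^sup>L (positive_variation (\<lambda>A. Im (\<mu> A))) f
        - integral\<^sup>L (positive_variation (\<lambda>A. - Im (\<mu> A))) f)"


section \<open>Heisenberg uniqueness pairs\<close>

definition arc_length_ac_measures :: "(real \<times> real) set \<Rightarrow> ((real \<times> real) set \<Rightarrow> complex) set" where
  "arc_length_ac_measures \<Gamma> =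
     {\<mu>. complex_borel_measure \<mu> \<and>
         (\<forall>A\<in>sets borel. A \<inter> \<Gamma> = {} \<longrightarrow> \<mu> A = 0) \<and>
         (\<forall>A\<in>null_sets (arc_length_measure \<Gamma>). \<mu> A = 0)}"

text \<open>
  The integral is over the whole plane; for \<open>\<mu>\<close> supported on \<open>\<Gamma>\<close> this is the integral over \<open>\<Gamma>\<close>.
\<close>

definition fourier_transform :: "((real \<times> real) set \<Rightarrow> complex) \<Rightarrow> real \<times> real \<Rightarrow> complex" where
  "fourier_transform \<mu> = (\<lambda>(\<xi>, \<eta>).
     complex_measure_integral \<mu> (\<lambda>(x, y). exp (- \<i> * of_real (pi * (x * \<xi> + y * \<eta>)))))"

text \<open>
  Meant for \<open>\<Gamma>\<close> with \<open>is_curve \<Gamma>\<close>; the unit circle is shown to be a curve below.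
  The conclusion \<open>\<mu> = 0\<close> is equality on the Borel sets.
\<close>

definition heisenberg_uniqueness_pair :: "(real \<times> real) set \<Rightarrow> (real \<times> real) set \<Rightarrow> bool" where
  "heisenberg_uniqueness_pair \<Gamma> \<Lambda> \<longleftrightarrow>
     (\<forall>\<mu>\<in>arc_length_ac_measures \<Gamma>.
        (\<forall>p\<in>\<Lambda>. fourier_transform \<mu> p = 0) \<longrightarrow> (\<forall>A\<in>sets borel. \<mu> A = 0))"

lemma is_curve_unit_circle: "is_curve (sphere (0, 0) 1)"
proof -
  define \<gamma> :: "real \<Rightarrow> real \<times> real" where "\<gamma> = (\<lambda>t. (cos t, sin t))"
  define D :: "nat \<Rightarrow> real \<Rightarrow> real \<times> real"
    where "D = (\<lambda>k t. (cos (t + k * (pi/2)), sin (t + k * (pi/2))))"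
  have D: "(D k has_vector_derivative D (Suc k) t) (at t within I)" for k t I
  proof -
    have 1: "cos (t + Suc k * (pi/2)) = - sin (t + k * (pi/2))"
            "sin (t + Suc k * (pi/2)) = cos (t + k * (pi/2))"
      using sin_add[of "t + k * (pi/2)" "pi/2"] cos_add[of "t + k * (pi/2)" "pi/2"]
      by (simp_all add: field_simps)
    show ?thesis
      unfolding D_def 1
      by (intro has_vector_derivative_Pair)
         (auto intro!: derivative_eq_intros simp flip: has_real_derivative_iff_has_vector_derivative)
  qed
  have inj: "inj_on \<gamma> {0..<2*pi}"
  proof (rule inj_onI)
    fix s t assume "s \<in> {0..<2*pi}" "t \<in> {0..<2*pi}" "\<gamma> s = \<gamma> t"
    then have "\<bar>s - t\<bar> < 2 * pi" "cos (s - t) = 1"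
      using sin_cos_squared_add3[of t] by (auto simp: \<gamma>_def cos_diff)
    then obtain n :: int where n: "s - t = n * 2 * pi"
      by (auto simp: cos_one_2pi_int)
    with \<open>\<bar>s - t\<bar> < 2 * pi\<close> have "\<bar>real_of_int n\<bar> * (2*pi) < 1 * (2*pi)"
      by (simp add: abs_mult)
    then have "\<bar>real_of_int n\<bar> < 1"
      by (subst (asm) mult_less_cancel_right) auto
    then have "n = 0" by linarith
    then show "s = t" using n by simp
  qed
  have "smooth_parametrization {0..<2*pi} \<gamma>"
    unfolding smooth_parametrization_def
  proof (intro conjI exI[of _ D])
    show "\<forall>t\<in>{0..<2*pi}. D 1 t \<noteq> 0"
    proof
      fix t :: real
      show "D 1 t \<noteq> 0"
        using sin_zero_norm_cos_one[of "t + pi/2"] by (auto simp: D_def zero_prod_def)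
    qed
  qed (use inj D pi_gt_zero in \<open>auto simp: D_def \<gamma>_def is_interval_co not_le[symmetric]\<close>)
  moreover have "sphere (0, 0) 1 = \<gamma> ` {0..<2*pi}"
  proof (intro equalityI subsetI)
    fix p :: "real \<times> real" assume "p \<in> sphere (0, 0) 1"
    then have "(fst p)\<^sup>2 + (snd p)\<^sup>2 = 1"
      by (cases p) (simp add: dist_Pair_Pair dist_real_def)
    then show "p \<in> \<gamma> ` {0..<2*pi}"
      using sincos_total_2pi[of "fst p" "snd p"] by (cases p) (force simp: \<gamma>_def)
  qed (auto simp: \<gamma>_def dist_Pair_Pair dist_real_def)
  ultimately have "curve_parametrization (sphere (0, 0) 1) 1 (\<lambda>_. {0..<2*pi}) (\<lambda>_. \<gamma>)"
    by (auto simp: curve_parametrization_def disjoint_family_on_def)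
  then show ?thesis unfolding is_curve_def by blast
qed

end

theory Submission
  imports Defs "HOL-Complex_Analysis.Complex_Analysis"
begin

text \<open>
  The transform of \<open>\<mu>\<close> extends to an entire function of two complex variables, and the spiral is
  the image of \<open>{..0}\<close> under the entire map \<open>t \<mapsto> (e\<^sup>t cos t, e\<^sup>t sin t)\<close>, so the transform vanishes on the image of
  the whole complex plane.  In the coordinates \<open>u = \<xi> - i\<eta>\<close>, \<open>v = \<xi> + i\<eta>\<close> that image is
  \<open>(e\<^bsup>(1-i)t\<^esup>, e\<^bsup>(1+i)t\<^esup>)\<close>; replacing \<open>t\<close> by \<open>t + 2\<pi>ik/(1-i)\<close> fixes \<open>u\<close> and multiplies \<open>v\<close> by
  \<open>e\<^bsup>-2\<pi>k\<^esup>\<close>.  Hence for fixed \<open>u \<noteq> 0\<close> the zeros in \<open>v\<close> accumulate at \<open>0\<close>, and the transform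
  vanishes identically.  At purely imaginary frequencies this says that \<open>\<mu>\<close> annihilates all real
  exponentials, which are total in the continuous functions on the circle by Stone--Weierstrass.
\<close>

section \<open>Jordan decomposition of signed measures\<close>

locale signed_borel_measure =
  fixes \<nu> :: "'a::topological_space set \<Rightarrow> real"
  assumes empty [simp]: "\<nu> {} = 0"
    and sums_UN: "\<And>A. range A \<subseteq> sets borel \<Longrightarrow> disjoint_family A \<Longrightarrow>
                   (\<lambda>i::nat. \<nu> (A i)) sums \<nu> (\<Union>i. A i)"
begin

lemma union:
  assumes [measurable]: "A \<in> sets borel" "B \<in> sets borel" and disj: "A \<inter> B = {}"
  shows "\<nu> (A \<union> B) = \<nu> A + \<nu> B"
proof -
  have "range (binaryset A B) \<subseteq> sets borel" "disjoint_family (binaryset A B)"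
    using disj by (auto simp: range_binaryset_eq disjoint_family_on_def binaryset_def)
  from sums_UN[OF this] have "(\<lambda>i. \<nu> (binaryset A B i)) sums \<nu> (A \<union> B)"
    by (simp add: UN_binaryset_eq)
  moreover have "(\<lambda>i. \<nu> (binaryset A B i)) sums (\<nu> A + \<nu> B)"
    by (rule binaryset_sums) simp
  ultimately show ?thesis by (rule sums_unique2)
qed

lemma diff:
  assumes [measurable]: "A \<in> sets borel" "B \<in> sets borel" and "B \<subseteq> A"
  shows "\<nu> (A - B) = \<nu> A - \<nu> B"
  using union[of B "A - B"] assms by (simp add: Un_absorb1)

lemma uminus: "signed_borel_measure (\<lambda>A. - \<nu> A)"
  by unfold_locales (auto intro: sums_minus sums_UN)

text \<open>The set function inside \<open>positive_variation\<close>, named apart because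
  \<open>measure_of\<close> silently returns the zero measure unless its argument is countably
  additive; that has to be proved first.\<close>

definition pos :: "'a set \<Rightarrow> ennreal"
  where "pos A = (SUP B \<in> {B \<in> sets borel. B \<subseteq> A}. ennreal (\<nu> B))"

lemma pos_upper: "B \<in> sets borel \<Longrightarrow> B \<subseteq> A \<Longrightarrow> ennreal (\<nu> B) \<le> pos A"
  unfolding pos_def by (rule SUP_upper) auto

lemma pos_mono: "A \<subseteq> A' \<Longrightarrow> pos A \<le> pos A'"
  unfolding pos_def by (rule SUP_subset_mono) auto

text \<open>Near-optimal Borel pieces of \<open>A\<close> and of \<open>B\<close> can be chosen
  independently, and being disjoint they combine to a competitor for
  \<open>A \<union> B\<close>.\<close>

lemma pos_superadditive:
  assumes "A \<inter> B = {}"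
  shows "pos A + pos B \<le> pos (A \<union> B)"
proof -
  have "ennreal (\<nu> C) + ennreal (\<nu> D) \<le> pos (A \<union> B)"
    if C: "C \<in> sets borel" "C \<subseteq> A" and D: "D \<in> sets borel" "D \<subseteq> B" for C D
  proof (cases "\<nu> C \<ge> 0 \<and> \<nu> D \<ge> 0")
    case True
    then have "ennreal (\<nu> C) + ennreal (\<nu> D) = ennreal (\<nu> (C \<union> D))"
      using union[of C D] that assms by (subst union) (auto simp: ennreal_plus)
    also have "\<dots> \<le> pos (A \<union> B)"
      using that by (intro pos_upper) auto
    finally show ?thesis .
  next
    \<comment> \<open>\<open>ennreal\<close> truncates a negative value to 0, so one summand
      vanishes and the other piece alone is the competitor; the union could have smaller
      value.\<close>
    case False
    then have "ennreal (\<nu> C) = 0 \<or> ennreal (\<nu> D) = 0"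
      by (auto simp: ennreal_neg)
    moreover have "ennreal (\<nu> C) \<le> pos (A \<union> B)" "ennreal (\<nu> D) \<le> pos (A \<union> B)"
      using that by (auto intro!: pos_upper)
    ultimately show ?thesis by auto
  qed
  note le = this
  have "ennreal (\<nu> C) + pos B \<le> pos (A \<union> B)" if "C \<in> sets borel" "C \<subseteq> A" for C
  proof -
    have "ennreal (\<nu> C) + pos B = (SUP D\<in>{D \<in> sets borel. D \<subseteq> B}. ennreal (\<nu> C) + ennreal (\<nu> D))"
      unfolding pos_def by (subst ennreal_SUP_add_right) auto
    also have "\<dots> \<le> pos (A \<union> B)"
      using le that by (intro SUP_least) auto
    finally show ?thesis .
  qed
  moreover have "pos A + pos B = (SUP C\<in>{C \<in> sets borel. C \<subseteq> A}. ennreal (\<nu> C) + pos B)"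
    unfolding pos_def[of A] by (subst ennreal_SUP_add_left) auto
  ultimately show ?thesis
    by (auto intro: SUP_least)
qed

text \<open>One inequality is superadditivity iterated over finite unions. For the other, a Borel
  subset of the union is cut along the \<open>A i\<close>, and countable additivity of
  \<open>\<nu>\<close> makes its value a limit of partial sums bounded piece by piece.\<close>

lemma countably_additive_pos: "countably_additive (sets borel) pos"
proof (rule countably_additiveI)
  fix A :: "nat \<Rightarrow> 'a set"
  assume A: "range A \<subseteq> sets borel" "disjoint_family A"
  show "(\<Sum>i. pos (A i)) = pos (\<Union>i. A i)"
  proof (rule antisym)
    have fin: "(\<Sum>i<n. pos (A i)) \<le> pos (\<Union>i<n. A i)" for n
    proof (induction n)
      case (Suc n)
      have "(\<Sum>i<Suc n. pos (A i)) \<le> pos (\<Union>i<n. A i) + pos (A n)"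
        using Suc by (simp add: add_right_mono)
      also have "\<dots> \<le> pos ((\<Union>i<n. A i) \<union> A n)"
        using A(2) by (intro pos_superadditive)
          (auto simp: disjoint_family_on_def dest: less_imp_neq)
      finally show ?case by (simp add: lessThan_Suc Un_commute)
    qed simp
    show "(\<Sum>i. pos (A i)) \<le> pos (\<Union>i. A i)"
    proof (rule suminf_le_const)
      fix n
      show "(\<Sum>i<n. pos (A i)) \<le> pos (\<Union>i. A i)"
        by (rule order_trans[OF fin pos_mono]) auto
    qed simp
    show "pos (\<Union>i. A i) \<le> (\<Sum>i. pos (A i))"
      unfolding pos_def[of "\<Union>i. A i"]
    proof (rule SUP_least)
      fix B assume "B \<in> {B \<in> sets borel. B \<subseteq> (\<Union>i. A i)}"
      then have B: "B \<in> sets borel" "B \<subseteq> (\<Union>i. A i)" by auto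
      have "(\<lambda>i. \<nu> (B \<inter> A i)) sums \<nu> (\<Union>i. B \<inter> A i)"
        using A B by (intro sums_UN) (auto simp: disjoint_family_on_def)
      moreover have "(\<Union>i. B \<inter> A i) = B" using B by auto
      ultimately have "(\<lambda>n. \<Sum>i<n. \<nu> (B \<inter> A i)) \<longlonglongrightarrow> \<nu> B"
        by (simp add: sums_def)
      then have "(\<lambda>n. ennreal (\<Sum>i<n. \<nu> (B \<inter> A i))) \<longlonglongrightarrow> ennreal (\<nu> B)"
        by (rule tendsto_ennrealI)
      moreover have "ennreal (\<Sum>i<n. \<nu> (B \<inter> A i)) \<le> (\<Sum>i. pos (A i))" for n
      proof -
        \<comment> \<open>Passing to positive parts first, since \<open>ennreal\<close> commutes
          with sums only of nonnegative terms.\<close>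
        have "ennreal (\<Sum>i<n. \<nu> (B \<inter> A i)) \<le> ennreal (\<Sum>i<n. max 0 (\<nu> (B \<inter> A i)))"
          by (intro ennreal_leI sum_mono) auto
        also have "\<dots> = (\<Sum>i<n. ennreal (max 0 (\<nu> (B \<inter> A i))))"
          by (rule sum_ennreal[symmetric]) auto
        also have "\<dots> \<le> (\<Sum>i<n. pos (A i))"
          using A B by (intro sum_mono) (auto simp: max_def intro!: pos_upper)
        also have "\<dots> \<le> (\<Sum>i. pos (A i))"
          by (rule sum_le_suminf) auto
        finally show ?thesis .
      qed
      ultimately show "ennreal (\<nu> B) \<le> (\<Sum>i. pos (A i))"
        by (intro LIMSEQ_le_const2) auto
    qed
  qed
qed

section \<open>The positive variation as a finite measure\<close>

lemma space_positive_variation [simp]: "space (positive_variation \<nu>) = UNIV"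
  by (simp add: positive_variation_def space_measure_of_conv)

lemma sets_positive_variation [simp, measurable_cong]:
  "sets (positive_variation \<nu>) = sets borel"
  using sets.sigma_sets_eq[of borel] by (simp add: positive_variation_def sets_measure_of_conv)

lemma emeasure_positive_variation:
  assumes "A \<in> sets borel"
  shows "emeasure (positive_variation \<nu>) A = pos A"
proof (rule emeasure_measure_of[where \<mu> = pos and \<Omega> = UNIV and A = "sets borel"])
  show "positive_variation \<nu> = measure_of UNIV (sets borel) pos"
    by (simp add: positive_variation_def pos_def[abs_def])
  show "positive (sets (positive_variation \<nu>)) pos"
    by (simp add: positive_def pos_def cong: conj_cong)
qed (use assms countably_additive_pos in auto)

text \<open>
  A set of infinite positive variation splits into a piece on which \<open>\<bar>\<nu>\<bar> \<ge> 1\<close> and another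
  set of infinite positive variation; iterating contradicts convergence of \<open>\<Sum>\<nu>\<close> over the pieces.
\<close>

lemma finite_measure_positive_variation: "finite_measure (positive_variation \<nu>)"
proof (rule ccontr)
  assume "\<not> finite_measure (positive_variation \<nu>)"
  then have UNIV: "pos UNIV = \<infinity>"
    using emeasure_positive_variation[of UNIV] by (auto intro: finite_measureI)
  define bad where "bad E \<longleftrightarrow> E \<in> sets borel \<and> pos E = \<infinity>" for E
  have step: "\<exists>D. bad D \<and> D \<subseteq> E \<and> \<bar>\<nu> (E - D)\<bar> \<ge> 1" if "bad E" for E
  proof -
    have E: "E \<in> sets borel" "pos E = \<infinity>" using that by (auto simp: bad_def)
    \<comment> \<open>The threshold \<open>1 + \<bar>\<nu> E\<bar>\<close> makes both
      \<open>\<nu> B\<close> and \<open>\<bar>\<nu> E - \<nu> B\<bar>\<close> exceed 1, so whichever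
      of \<open>B\<close> and \<open>E - B\<close> stays bad, the discarded piece is large.\<close>
    have "\<exists>B\<in>{B \<in> sets borel. B \<subseteq> E}. ennreal (1 + \<bar>\<nu> E\<bar>) < ennreal (\<nu> B)"
      unfolding less_SUP_iff[symmetric] pos_def[symmetric] E by simp
    then obtain B where B: "B \<in> sets borel" "B \<subseteq> E" "1 + \<bar>\<nu> E\<bar> < \<nu> B"
      using ennreal_less_iff[of "1 + \<bar>\<nu> E\<bar>"] by auto
    have "pos B + pos (E - B) = pos E"
      using plus_emeasure[of B "positive_variation \<nu>" "E - B"] E B
      by (simp add: emeasure_positive_variation Un_absorb1)
    then have "bad B \<or> bad (E - B)"
      using E B by (auto simp: bad_def ennreal_add_eq_top)
    moreover have "E - (E - B) = B" using B by auto
    ultimately show ?thesis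
      using B diff[OF E(1) B(1,2)] by (elim disjE) (auto intro: exI[of _ B] exI[of _ "E - B"])
  qed
  have "\<exists>D. \<forall>n. bad (D n) \<and> D (Suc n) \<subseteq> D n \<and> \<bar>\<nu> (D n - D (Suc n))\<bar> \<ge> 1"
  proof (rule dependent_nat_choice)
    show "\<exists>E. bad E" using UNIV by (auto simp: bad_def intro!: exI[of _ UNIV])
    show "\<exists>D. bad D \<and> D \<subseteq> E \<and> \<bar>\<nu> (E - D)\<bar> \<ge> 1" if "bad E" for E and n :: nat
      using step[OF that] .
  qed
  then obtain D where D: "\<And>n. bad (D n)" "\<And>n. D (Suc n) \<subseteq> D n"
    and large: "\<And>n. \<bar>\<nu> (D n - D (Suc n))\<bar> \<ge> 1"
    by auto
  have anti: "D n \<subseteq> D m" if "m \<le> n" for m n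
    using D(2) that by (rule lift_Suc_antimono_le)
  have "(\<lambda>n. \<nu> (D n - D (Suc n))) sums \<nu> (\<Union>n. D n - D (Suc n))"
  proof (rule sums_UN)
    show "range (\<lambda>n. D n - D (Suc n)) \<subseteq> sets borel"
      using D(1) by (auto simp: bad_def)
    have "(D m - D (Suc m)) \<inter> (D n - D (Suc n)) = {}" if "m < n" for m n
      using anti[of "Suc m" n] that by auto
    then show "disjoint_family (\<lambda>n. D n - D (Suc n))"
      unfolding disjoint_family_on_def by (metis inf_commute linorder_neqE_nat)
  qed
  then have "(\<lambda>n. \<nu> (D n - D (Suc n))) \<longlonglongrightarrow> 0"
    using summable_LIMSEQ_zero sums_summable by blast
  then have "\<forall>\<^sub>F n in sequentially. \<bar>\<nu> (D n - D (Suc n))\<bar> < 1"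
    by (auto dest: tendstoD[where e = 1])
  then show False
    using large by (simp flip: not_le)
qed

text \<open>For Borel \<open>B \<subseteq> A\<close>,
  \<open>\<nu> B = \<nu> A - \<nu> (A - B)\<close>, and \<open>- \<nu> (A - B)\<close> is at most
  the negative variation of \<open>A\<close>; then the supremum over \<open>B\<close> is taken.
  Applied to \<open>\<nu>\<close> and to \<open>- \<nu>\<close> this yields the Jordan decomposition
  without a Hahn decomposition.\<close>

lemma measure_positive_variation_le:
  assumes A: "A \<in> sets borel"
  shows "measure (positive_variation \<nu>) A \<le> \<nu> A + measure (positive_variation (\<lambda>A. - \<nu> A)) A"
proof -
  interpret neg: signed_borel_measure "\<lambda>A. - \<nu> A" by (rule uminus)
  interpret P: finite_measure "positive_variation \<nu>" by (rule finite_measure_positive_variation)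
  interpret N: finite_measure "positive_variation (\<lambda>A. - \<nu> A)"
    by (rule neg.finite_measure_positive_variation)
  let ?N = "measure (positive_variation (\<lambda>A. - \<nu> A))"
  have N: "- \<nu> B \<le> ?N A" if "B \<in> sets borel" "B \<subseteq> A" for B
  proof -
    have "ennreal (- \<nu> B) \<le> ennreal (?N A)"
      using neg.pos_upper[OF that] A
      by (simp add: neg.emeasure_positive_variation[symmetric] N.emeasure_eq_measure)
    then show ?thesis by (simp add: ennreal_le_iff)
  qed
  have "ennreal (\<nu> B) \<le> ennreal (\<nu> A + ?N A)" if "B \<in> sets borel" "B \<subseteq> A" for B
    using N[of "A - B"] diff[OF A that] that A by (intro ennreal_leI) auto
  then have "emeasure (positive_variation \<nu>) A \<le> ennreal (\<nu> A + ?N A)"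
    unfolding emeasure_positive_variation[OF A] pos_def by (auto intro!: SUP_least)
  moreover have "0 \<le> \<nu> A + ?N A"
    using N[OF A] by simp
  ultimately show ?thesis
    by (simp add: P.emeasure_eq_measure ennreal_le_iff)
qed

lemma jordan_decomposition:
  assumes "A \<in> sets borel"
  shows "\<nu> A = measure (positive_variation \<nu>) A - measure (positive_variation (\<lambda>A. - \<nu> A)) A"
proof -
  interpret neg: signed_borel_measure "\<lambda>A. - \<nu> A" by (rule uminus)
  show ?thesis
    using measure_positive_variation_le[OF assms] neg.measure_positive_variation_le[OF assms]
    by simp
qed

lemma AE_positive_variation:
  assumes "S \<in> sets borel" "\<And>A. A \<in> sets borel \<Longrightarrow> A \<inter> S = {} \<Longrightarrow> \<nu> A = 0"
  shows "AE x in positive_variation \<nu>. x \<in> S"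
proof (rule AE_I)
  have "\<nu> B = 0" if "B \<in> sets borel" "B \<subseteq> - S" for B
    using assms(2) that by blast
  then have "pos (- S) \<le> 0"
    unfolding pos_def by (intro SUP_least) simp
  then show "emeasure (positive_variation \<nu>) (- S) = 0"
    using assms(1) by (simp add: emeasure_positive_variation)
  show "- S \<in> sets (positive_variation \<nu>)"
    using assms(1) by simp
qed auto

end


section \<open>Uniqueness of finite measures\<close>

text \<open>Closed sets form an intersection-stable generator of the Borel sets, and the indicator
  of a closed set is a bounded pointwise limit of continuous functions of the distance to
  it.\<close>

lemma finite_measure_eqI_bounded_continuous:
  fixes M N :: "'a::metric_space measure"
  assumes "finite_measure M" "finite_measure N"
    and [measurable_cong]: "sets M = sets borel" "sets N = sets borel"
    and eq: "\<And>g :: 'a \<Rightarrow> real. continuous_on UNIV g \<Longrightarrow> bounded (range g) \<Longrightarrow>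
                integral\<^sup>L M g = integral\<^sup>L N g"
  shows "M = N"
proof -
  interpret M: finite_measure M by fact
  interpret N: finite_measure N by fact
  have space: "space M = UNIV" "space N = UNIV"
    using assms(3,4)[THEN sets_eq_imp_space_eq] by auto
  have closed: "measure M A = measure N A" if "closed A" for A
  \<comment> \<open>\<open>infdist x {}\<close> is 0 by convention, so for the empty set the
    functions \<open>g n\<close> would be constantly 1.\<close>
  proof (cases "A = {}")
    case False
    define g where "g n x = max 0 (1 - real n * infdist x A)" for n x
    have cont: "continuous_on UNIV (g n)" for n
      unfolding g_def by (intro continuous_intros)
    have bound: "norm (g n x) \<le> 1" for n x
      using infdist_nonneg[of x A] by (simp add: g_def)
    have A [measurable]: "A \<in> sets borel" using that by simp
    have [measurable]: "g n \<in> borel_measurable borel" for n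
      using cont by (rule borel_measurable_continuous_onI)
    have lim: "(\<lambda>n. g n x) \<longlonglongrightarrow> indicator A x" for x
    proof (cases "x \<in> A")
      case True
      then show ?thesis by (simp add: g_def)
    next
      case notin: False
      then have pos: "infdist x A > 0"
        using in_closed_iff_infdist_zero[OF that False] infdist_nonneg[of x A] by force
      obtain m :: nat where m: "1 < real m * infdist x A"
        using reals_Archimedean3[OF pos] by blast
      have "g n x = 0" if "n \<ge> m" for n
      proof -
        have "real m * infdist x A \<le> real n * infdist x A"
          using that pos by (intro mult_right_mono) auto
        then show ?thesis using m by (simp add: g_def)
      qed
      then have "\<forall>\<^sub>F n in sequentially. g n x = indicator A x"
        using notin by (auto simp: eventually_sequentially)
      then show ?thesis by (rule tendsto_eventually)
    qed
    have "(\<lambda>n. integral\<^sup>L M (g n)) \<longlonglongrightarrow> integral\<^sup>L M (indicator A)"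
      by (rule integral_dominated_convergence[where w = "\<lambda>_. 1"]) (auto simp: lim bound[simplified])
    moreover have "(\<lambda>n. integral\<^sup>L N (g n)) \<longlonglongrightarrow> integral\<^sup>L N (indicator A)"
      by (rule integral_dominated_convergence[where w = "\<lambda>_. 1"]) (auto simp: lim bound[simplified])
    moreover have "integral\<^sup>L M (g n) = integral\<^sup>L N (g n)" for n
      using cont bound by (intro eq) (auto simp: bounded_iff)
    ultimately have "integral\<^sup>L M (indicator A) = integral\<^sup>L N (indicator A :: 'a \<Rightarrow> real)"
      using LIMSEQ_unique by force
    then show ?thesis by (simp add: space)
  qed simp
  show ?thesis
  proof (rule measure_eqI_generator_eq[where E = "Collect closed" and \<Omega> = UNIV and A = "\<lambda>_. UNIV"])
    show "Int_stable (Collect (closed :: 'a set \<Rightarrow> bool))"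
      by (auto simp: Int_stable_def)
    show "emeasure M X = emeasure N X" if "X \<in> Collect closed" for X
      using closed that by (simp add: M.emeasure_eq_measure N.emeasure_eq_measure)
    show "sets M = sigma_sets UNIV (Collect closed)" "sets N = sigma_sets UNIV (Collect closed)"
      using assms(3,4) by (simp_all add: borel_eq_closed)
  qed auto
qed

text \<open>The real linear span of the functions \<open>exp (a \<bullet> x)\<close>. Since
  frequencies add under multiplication, it is an algebra, as Stone-Weierstrass requires.\<close>

inductive_set exponential_sums :: "('a::euclidean_space \<Rightarrow> real) set" where
  exp: "(\<lambda>x. c * exp (a \<bullet> x)) \<in> exponential_sums"
| add: "f \<in> exponential_sums \<Longrightarrow> g \<in> exponential_sums \<Longrightarrow> (\<lambda>x. f x + g x) \<in> exponential_sums"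

lemma exponential_sums_mult:
  assumes "f \<in> exponential_sums" "g \<in> exponential_sums"
  shows "(\<lambda>x. f x * g x) \<in> exponential_sums"
  using assms
proof (induction rule: exponential_sums.induct)
  case (exp c a)
  from exp show ?case
  proof (induction rule: exponential_sums.induct)
    case (exp d b)
    have "(\<lambda>x. c * exp (a \<bullet> x) * (d * exp (b \<bullet> x))) = (\<lambda>x. (c * d) * exp ((a + b) \<bullet> x))"
      by (simp add: exp_add inner_add_left fun_eq_iff)
    then show ?case by (simp only: exponential_sums.exp)
  next
    case (add f g)
    then show ?case by (simp add: distrib_left exponential_sums.add)
  qed
next
  case (add f g)
  then show ?case by (simp add: distrib_right exponential_sums.add)
qed

lemma continuous_on_exponential_sums: "f \<in> exponential_sums \<Longrightarrow> continuous_on S f"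
  by (induction rule: exponential_sums.induct) (auto intro!: continuous_intros)

lemma function_ring_on_exponential_sums:
  fixes S :: "'a::euclidean_space set"
  assumes "compact S"
  shows "function_ring_on exponential_sums S"
proof
  show "(\<lambda>_. c) \<in> exponential_sums" for c
    using exponential_sums.exp[of c 0] by simp
  fix x y :: 'a assume "x \<noteq> y"
  \<comment> \<open>The frequency \<open>x - y\<close> separates \<open>x\<close> from
    \<open>y\<close>: the two inner products differ by the squared norm of
    \<open>x - y\<close>.\<close>
  then have "(x - y) \<bullet> x \<noteq> (x - y) \<bullet> y"
    using inner_eq_zero_iff[of "x - y"] by (auto simp: inner_diff_right)
  then show "\<exists>f\<in>exponential_sums. f x \<noteq> f y"
    by (intro bexI[OF _ exponential_sums.exp[of 1 "x - y"]]) simp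
qed (auto intro: assms continuous_on_exponential_sums exponential_sums_mult exponential_sums.add)

lemma (in finite_measure) abs_integral_diff_le:
  fixes f g :: "'a \<Rightarrow> real"
  assumes "integrable M f" "integrable M g" "AE x in M. \<bar>f x - g x\<bar> \<le> e"
  shows "\<bar>integral\<^sup>L M f - integral\<^sup>L M g\<bar> \<le> e * measure M (space M)"
proof -
  have "\<bar>integral\<^sup>L M f - integral\<^sup>L M g\<bar> = \<bar>\<integral>x. f x - g x \<partial>M\<bar>"
    using assms by simp
  also have "\<dots> \<le> (\<integral>x. \<bar>f x - g x\<bar> \<partial>M)"
    by (rule integral_abs_bound)
  also have "\<dots> \<le> (\<integral>x. e \<partial>M)"
    using assms by (intro integral_mono_AE) auto
  finally show ?thesis by (simp add: mult.commute)
qed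

text \<open>By linearity the integrals agree on exponential sums. These approximate every continuous
  function uniformly on \<open>S\<close>, which carries both measures.\<close>

lemma finite_measure_eqI_mgf:
  fixes M N :: "'a::euclidean_space measure"
  assumes "finite_measure M" "finite_measure N"
    and sets [measurable_cong]: "sets M = sets borel" "sets N = sets borel"
    and S: "compact S" "AE x in M. x \<in> S" "AE x in N. x \<in> S"
    and eq: "\<And>a. (\<integral>x. exp (a \<bullet> x) \<partial>M) = (\<integral>x. exp (a \<bullet> x) \<partial>N)"
  shows "M = N"
proof (rule finite_measure_eqI_bounded_continuous)
  interpret M: finite_measure M by fact
  interpret N: finite_measure N by fact
  interpret function_ring_on exponential_sums S
    using S(1) by (rule function_ring_on_exponential_sums)
  \<comment> \<open>Exponentials are unbounded on the whole space; integrability comes from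
    boundedness on the compact set \<open>S\<close>.\<close>
  have int: "integrable M f" "integrable N f" if cont: "continuous_on UNIV f" for f :: "'a \<Rightarrow> real"
  proof -
    obtain B where B: "\<And>x. x \<in> S \<Longrightarrow> norm (f x) \<le> B"
      using compact_imp_bounded[OF compact_continuous_image[OF continuous_on_subset[OF cont subset_UNIV] S(1)]]
      by (auto simp: bounded_iff)
    have "f \<in> borel_measurable borel"
      using cont by (rule borel_measurable_continuous_onI)
    then have meas: "f \<in> borel_measurable M" "f \<in> borel_measurable N" by measurable
    have "AE x in M. norm (f x) \<le> B" "AE x in N. norm (f x) \<le> B"
      using S(2,3) B by (auto elim: eventually_mono)
    then show "integrable M f" "integrable N f"
      using M.integrable_const_bound[OF _ meas(1)] N.integrable_const_bound[OF _ meas(2)] by auto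
  qed
  have ring: "integral\<^sup>L M f = integral\<^sup>L N f" if "f \<in> exponential_sums" for f
    using that
  proof (induction rule: exponential_sums.induct)
    case (add f g)
    then show ?case by (simp add: int continuous_on_exponential_sums)
  qed (simp add: eq)
  fix g :: "'a \<Rightarrow> real" assume g: "continuous_on UNIV g"
  have approx: "\<bar>integral\<^sup>L M g - integral\<^sup>L N g\<bar> \<le> e * (measure M UNIV + measure N UNIV)"
    if "e > 0" for e
  proof -
    obtain f where f: "f \<in> exponential_sums" "\<And>x. x \<in> S \<Longrightarrow> \<bar>g x - f x\<bar> < e"
      using Stone_Weierstrass_basic[OF continuous_on_subset[OF g subset_UNIV] \<open>e > 0\<close>] by auto
    note cont = continuous_on_exponential_sums[OF f(1), of UNIV]
    have space: "space M = UNIV" "space N = UNIV"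
      using sets[THEN sets_eq_imp_space_eq] by auto
    have "AE x in M. \<bar>g x - f x\<bar> \<le> e" "AE x in N. \<bar>g x - f x\<bar> \<le> e"
      using S(2,3) by (auto elim!: eventually_mono dest: f(2))
    then have "\<bar>integral\<^sup>L M g - integral\<^sup>L M f\<bar> \<le> e * measure M (space M)"
      "\<bar>integral\<^sup>L N g - integral\<^sup>L N f\<bar> \<le> e * measure N (space N)"
      by (auto intro!: M.abs_integral_diff_le N.abs_integral_diff_le int g cont)
    then show ?thesis
      using ring[OF f(1)] unfolding space distrib_left by linarith
  qed
  have "\<bar>integral\<^sup>L M g - integral\<^sup>L N g\<bar> \<le> 0"
  proof (rule field_le_epsilon)
    fix e :: real assume "e > 0"
    \<comment> \<open>The summand 1 keeps \<open>K\<close> positive even if both measures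
      vanish.\<close>
    define K where "K = measure M UNIV + measure N UNIV + 1"
    have "K > 0" unfolding K_def by (simp add: add_nonneg_pos)
    then have "\<bar>integral\<^sup>L M g - integral\<^sup>L N g\<bar> \<le> e / K * (K - 1)"
      using approx[of "e / K"] \<open>e > 0\<close> by (simp add: K_def)
    also have "\<dots> \<le> e"
      using \<open>K > 0\<close> \<open>e > 0\<close> by (simp add: field_simps)
    finally show "\<bar>integral\<^sup>L M g - integral\<^sup>L N g\<bar> \<le> 0 + e" by simp
  qed
  then show "integral\<^sup>L M g = integral\<^sup>L N g" by simp
qed (fact assms)+

text \<open>The two variations coincide as measures, so their difference, which is
  \<open>\<nu>\<close>, cancels.\<close>

lemma signed_measure_eq_0_mgf:
  fixes \<nu> :: "'a::euclidean_space set \<Rightarrow> real"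
  assumes "signed_borel_measure \<nu>"
    and S: "compact S" "\<And>A. A \<in> sets borel \<Longrightarrow> A \<inter> S = {} \<Longrightarrow> \<nu> A = 0"
    and eq: "\<And>a. (\<integral>x. exp (a \<bullet> x) \<partial>positive_variation \<nu>) =
                 (\<integral>x. exp (a \<bullet> x) \<partial>positive_variation (\<lambda>A. - \<nu> A))"
    and "A \<in> sets borel"
  shows "\<nu> A = 0"
proof -
  interpret signed_borel_measure \<nu> by fact
  interpret neg: signed_borel_measure "\<lambda>A. - \<nu> A" by (rule uminus)
  have "positive_variation \<nu> = positive_variation (\<lambda>A. - \<nu> A)"
  proof (rule finite_measure_eqI_mgf[OF _ _ _ _ S(1) _ _ eq])
    have "S \<in> sets borel" using S(1) by (rule borel_compact)
    then show "AE x in positive_variation \<nu>. x \<in> S" "AE x in positive_variation (\<lambda>A. - \<nu> A). x \<in> S"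
      using S(2) by (auto intro!: AE_positive_variation neg.AE_positive_variation)
  qed (simp_all add: finite_measure_positive_variation neg.finite_measure_positive_variation)
  then show ?thesis
    using jordan_decomposition[OF \<open>A \<in> sets borel\<close>] by simp
qed


section \<open>Entire transforms\<close>

text \<open>Differentiation under the integral: the bound on \<open>f'\<close> controls the
  difference quotients, and dominated convergence applies along sequences. In \<open>bound\<close>
  one null set serves all \<open>z\<close> in the disc.\<close>

lemma (in finite_measure) holomorphic_on_integral:
  fixes f f' :: "complex \<Rightarrow> 'a \<Rightarrow> complex"
  assumes int: "\<And>z. integrable M (f z)"
    and meas [measurable]: "\<And>z. f' z \<in> borel_measurable M"
    and deriv: "\<And>z x. ((\<lambda>z. f z x) has_field_derivative f' z x) (at z)"
    and bound: "\<And>r. \<exists>B. AE x in M. \<forall>z\<in>cball 0 r. norm (f' z x) \<le> B"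
  shows "(\<lambda>z. \<integral>x. f z x \<partial>M) holomorphic_on UNIV"
proof -
  let ?F = "\<lambda>z. \<integral>x. f z x \<partial>M"
  have [measurable]: "f z \<in> borel_measurable M" for z
    using int by auto
  have "(?F has_field_derivative (\<integral>x. f' z x \<partial>M)) (at z)" for z
    unfolding DERIV_def tendsto_at_iff_sequentially
  proof (intro allI impI)
    fix X :: "nat \<Rightarrow> complex" assume X: "\<forall>i. X i \<in> UNIV - {0}" "X \<longlonglongrightarrow> 0"
    \<comment> \<open>All points \<open>z + X i\<close> then lie in one disc, hence a convex set, on
      which the mean value inequality can use \<open>bound\<close>.\<close>
    obtain K where K: "\<And>i. norm (X i) \<le> K"
      using convergent_imp_Bseq[of X] X(2) by (auto simp: convergent_def Bseq_def)
    obtain B where B: "AE x in M. \<forall>w\<in>cball 0 (norm z + K). norm (f' w x) \<le> B"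
      using bound by blast
    have "K \<ge> 0" using norm_ge_zero[of "X 0"] K[of 0] by linarith
    have quot: "norm ((f (z + X i) x - f z x) / X i) \<le> B"
      if B: "\<forall>w\<in>cball 0 (norm z + K). norm (f' w x) \<le> B" for i x
    proof -
      have "norm (f (z + X i) x - f z x) \<le> B * norm (z + X i - z)"
      proof (rule field_differentiable_bound)
        show "z + X i \<in> cball 0 (norm z + K)" "z \<in> cball 0 (norm z + K)"
          using \<open>K \<ge> 0\<close> K[of i] norm_triangle_ineq[of z "X i"] by simp_all
        show "norm (f' w x) \<le> B" if "w \<in> cball 0 (norm z + K)" for w
          using B that by blast
      qed (auto intro: has_field_derivative_at_within deriv)
      then show ?thesis
        using X(1) by (simp add: norm_divide divide_le_eq)
    qed
    have "(\<lambda>i. \<integral>x. (f (z + X i) x - f z x) / X i \<partial>M) \<longlonglongrightarrow> (\<integral>x. f' z x \<partial>M)"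
    proof (rule integral_dominated_convergence[where w = "\<lambda>_. B"])
      show "AE x in M. (\<lambda>i. (f (z + X i) x - f z x) / X i) \<longlonglongrightarrow> f' z x"
        using deriv[of _ z] X unfolding DERIV_def tendsto_at_iff_sequentially comp_def by blast
      show "AE x in M. norm ((f (z + X i) x - f z x) / X i) \<le> B" for i
        using B by eventually_elim (rule quot)
    qed auto
    then show "((\<lambda>h. (?F (z + h) - ?F z) / h) \<circ> X) \<longlonglongrightarrow> (\<integral>x. f' z x \<partial>M)"
      by (simp add: comp_def int)
  qed
  then show ?thesis
    by (auto simp: holomorphic_on_def field_differentiable_def intro: has_field_derivative_at_within)
qed

text \<open>Holomorphy along every entire curve \<open>(\<alpha> z, \<beta> z)\<close> stands in for
  joint holomorphy in two variables. The bounded support makes the derivative in \<open>z\<close>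
  bounded on each disc.\<close>

lemma integral_exp_linear_holomorphic:
  fixes M :: "(real \<times> real) measure"
  assumes "finite_measure M" and [measurable_cong]: "sets M = sets borel"
    and supp: "AE p in M. norm p \<le> K"
    and hol: "\<alpha> holomorphic_on UNIV" "\<beta> holomorphic_on UNIV"
  shows "(\<lambda>z. \<integral>(x, y). exp (\<alpha> z * of_real x + \<beta> z * of_real y) \<partial>M) holomorphic_on UNIV"
proof -
  interpret finite_measure M by fact
  define f where "f z p = exp (\<alpha> z * of_real (fst p) + \<beta> z * of_real (snd p))" for z p
  define f' where "f' z p = f z p * (deriv \<alpha> z * of_real (fst p) + deriv \<beta> z * of_real (snd p))"
    for z p
  have lin: "norm (a * of_real (fst p) + b * of_real (snd p)) \<le> (norm a + norm b) * K"
    if "norm p \<le> K" for a b :: complex and p :: "real \<times> real"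
  proof -
    have "\<bar>fst p\<bar> \<le> K" "\<bar>snd p\<bar> \<le> K"
      using norm_fst_le[of "fst p" "snd p"] norm_snd_le[of "snd p" "fst p"] that by auto
    then show ?thesis
      by (auto intro!: norm_triangle_le add_mono mult_left_mono simp: norm_mult distrib_right)
  qed
  have f: "norm (f z p) \<le> exp ((norm (\<alpha> z) + norm (\<beta> z)) * K)" if "norm p \<le> K" for z p
    unfolding f_def using norm_exp lin[OF that] order_trans exp_le_cancel_iff by metis
  have meas: "f z \<in> borel_measurable borel" "f' z \<in> borel_measurable borel" for z
    unfolding f'_def f_def by (intro borel_measurable_continuous_onI continuous_intros)+
  have "(\<lambda>z. integral\<^sup>L M (f z)) holomorphic_on UNIV"
  proof (rule holomorphic_on_integral)
    show "integrable M (f z)" for z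
      using supp f meas by (intro integrable_const_bound[where B = "exp ((norm (\<alpha> z) + norm (\<beta> z)) * K)"]) auto
    show "f' z \<in> borel_measurable M" for z
      using meas by measurable
    have *: "(g has_field_derivative deriv g z) (at z)" if "g holomorphic_on UNIV" for g z
      using that by (intro holomorphic_derivI[of _ UNIV]) auto
    show "((\<lambda>z. f z p) has_field_derivative f' z p) (at z)" for z p
      unfolding f'_def f_def by (auto intro!: derivative_eq_intros *[OF hol(1)] *[OF hol(2)])
    fix r :: real
    define S where "S = cball (0::complex) r"
    have bdd: "\<exists>A. \<forall>z\<in>S. norm (g z) \<le> A" if "g holomorphic_on UNIV" for g :: "complex \<Rightarrow> complex"
    proof -
      have "compact (g ` S)"
        unfolding S_def using that holomorphic_on_subset
        by (intro compact_continuous_image holomorphic_on_imp_continuous_on) auto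
      then show ?thesis
        by (meson bounded_iff compact_imp_bounded imageI)
    qed
    obtain A1 A2 A3 A4 where A: "\<And>z. z \<in> S \<Longrightarrow> norm (\<alpha> z) \<le> A1" "\<And>z. z \<in> S \<Longrightarrow> norm (\<beta> z) \<le> A2"
      "\<And>z. z \<in> S \<Longrightarrow> norm (deriv \<alpha> z) \<le> A3" "\<And>z. z \<in> S \<Longrightarrow> norm (deriv \<beta> z) \<le> A4"
      using bdd[of \<alpha>] bdd[of \<beta>] bdd[of "deriv \<alpha>"] bdd[of "deriv \<beta>"] hol
      by (metis holomorphic_deriv open_UNIV)
    have "norm (f' z p) \<le> exp ((A1 + A2) * K) * ((A3 + A4) * K)"
      if z: "z \<in> S" and p: "norm p \<le> K" for z p
    proof -
      have "K \<ge> 0" using norm_ge_zero[of p] p by linarith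
      then have "norm (f z p) \<le> exp ((A1 + A2) * K)"
        using A(1,2)[OF z] by (intro order_trans[OF f[OF p]]) (auto intro!: mult_right_mono add_mono)
      moreover have "norm (deriv \<alpha> z * of_real (fst p) + deriv \<beta> z * of_real (snd p)) \<le> (A3 + A4) * K"
        using A(3,4)[OF z] \<open>K \<ge> 0\<close>
        by (intro order_trans[OF lin[OF p]]) (auto intro!: mult_right_mono add_mono)
      ultimately show ?thesis
        unfolding f'_def norm_mult by (intro mult_mono) auto
    qed
    then show "\<exists>B. AE p in M. \<forall>z\<in>cball 0 r. norm (f' z p) \<le> B"
      using supp by (intro exI[of _ "exp ((A1 + A2) * K) * ((A3 + A4) * K)"]) (auto simp: S_def)
  qed
  then show ?thesis
    by (simp add: f_def[abs_def] case_prod_unfold)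
qed


section \<open>Uniqueness on the spiral\<close>

text \<open>\<open>E\<close> plays an entire function of two variables, known only along entire
  curves, so that the one-variable identity theorem suffices. It is used three times: along the
  spiral, in \<open>v\<close>, and in \<open>u\<close>.\<close>

lemma vanishing_on_spiral:
  fixes E :: "complex \<Rightarrow> complex \<Rightarrow> complex"
  assumes hol: "\<And>\<alpha> \<beta>. \<alpha> holomorphic_on UNIV \<Longrightarrow> \<beta> holomorphic_on UNIV \<Longrightarrow>
                  (\<lambda>z. E (\<alpha> z) (\<beta> z)) holomorphic_on UNIV"
    and spiral: "\<And>t::real. t \<le> 0 \<Longrightarrow> E (of_real (exp t * cos t)) (of_real (exp t * sin t)) = 0"
  shows "E \<xi> \<eta> = 0"
proof -
  have spiral': "E (exp t * cos t) (exp t * sin t) = 0" for t :: complex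
  proof (rule analytic_continuation[of "\<lambda>t. E (exp t * cos t) (exp t * sin t)" UNIV "of_real ` {..0}" 0])
    show "(\<lambda>t. E (exp t * cos t) (exp t * sin t)) holomorphic_on UNIV"
      by (intro hol holomorphic_intros)
    show "(0::complex) islimpt of_real ` {..0}"
      unfolding islimpt_approachable
    proof (intro allI impI)
      fix e :: real assume "e > 0"
      then have "of_real (- e / 2) \<in> of_real ` {..0}" "of_real (- e / 2) \<noteq> (0::complex)"
        "dist (of_real (- e / 2)) (0::complex) < e"
        by (simp_all only: imageI atMost_iff) (auto simp: norm_divide)
      then show "\<exists>x'\<in>of_real ` {..0}. x' \<noteq> (0::complex) \<and> dist x' 0 < e" by blast
    qed
    show "E (exp z * cos z) (exp z * sin z) = 0" if "z \<in> of_real ` {..0}" for z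
      using that spiral by (auto simp: cos_of_real sin_of_real exp_of_real)
  qed auto
  \<comment> \<open>\<open>E\<close> in the coordinates \<open>u = \<xi> - \<i> * \<eta>\<close>,
    \<open>v = \<xi> + \<i> * \<eta>\<close>; the arguments are the inverse substitution.\<close>
  define G where "G u v = E ((u + v) / 2) ((v - u) / (2 * \<i>))" for u v
  have G_spiral: "G (exp ((1 - \<i>) * t)) (exp ((1 + \<i>) * t)) = 0" for t
  proof -
    have "exp ((1 - \<i>) * t) = exp t * exp (- (\<i> * t))" "exp ((1 + \<i>) * t) = exp t * exp (\<i> * t)"
      by (simp_all add: algebra_simps flip: exp_add)
    then have "(exp ((1 - \<i>) * t) + exp ((1 + \<i>) * t)) / 2 = exp t * cos t"
      "(exp ((1 + \<i>) * t) - exp ((1 - \<i>) * t)) / (2 * \<i>) = exp t * sin t"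
      by (simp_all add: cos_exp_eq sin_exp_eq field_simps)
    then show ?thesis
      using spiral'[of t] by (simp add: G_def)
  qed
  have G_nz: "G u v = 0" if "u \<noteq> 0" for u v
  proof -
    \<comment> \<open>The values of \<open>v\<close> on the spiral over the given \<open>u\<close>:
      as \<open>(1 + \<i>) / (1 - \<i>) = \<i>\<close>, the logarithm
      \<open>Ln u + 2 * pi * k * \<i>\<close> of \<open>u\<close> gives
      \<open>v = exp (\<i> * Ln u) * exp (- 2 * pi * k)\<close>.\<close>
    define V where "V k = exp (\<i> * Ln u) * of_real (exp (- (2 * pi)) ^ k)" for k :: nat
    have zero: "G u (V k) = 0" for k
    proof -
      \<comment> \<open>The solution of \<open>(1 - \<i>) * t = Ln u + 2 * pi * k * \<i>\<close>,
        because \<open>1 / (1 - \<i>) = (1 + \<i>) / 2\<close>.\<close>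
      define t where "t = (Ln u + 2 * pi * k * \<i>) * (1 + \<i>) / 2"
      have "(1 - \<i>) * t = Ln u + 2 * pi * k * \<i>" "(1 + \<i>) * t = \<i> * Ln u + of_real (k * (- (2 * pi)))"
        by (simp_all add: t_def complex_eq_iff field_simps)
      moreover have "exp (Ln u + 2 * pi * k * \<i>) = u"
        using that exp_of_nat_mult[of k "2 * pi * \<i>"] by (simp add: exp_add mult_ac)
      moreover have "exp (\<i> * Ln u + of_real (k * (- (2 * pi)))) = V k"
        unfolding V_def exp_add exp_of_real exp_of_nat_mult by simp
      ultimately show ?thesis using G_spiral[of t] by simp
    qed
    have lim: "0 islimpt range V"
      unfolding islimpt_sequential
    proof (intro exI conjI allI)
      have "(\<lambda>k. exp (- (2 * pi)) ^ k) \<longlonglongrightarrow> 0"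
        by (rule LIMSEQ_realpow_zero) auto
      then show "V \<longlonglongrightarrow> 0"
        unfolding V_def by (auto intro!: tendsto_eq_intros)
    qed (auto simp: V_def)
    have "(\<lambda>v. G u v) holomorphic_on UNIV"
      unfolding G_def by (intro hol holomorphic_intros) auto
    from this _ _ _ _ lim show ?thesis
      by (rule analytic_continuation) (use zero in auto)
  qed
  \<comment> \<open>No point of the complexified spiral has \<open>u = 0\<close>; that line is
    reached by continuation in \<open>u\<close> with \<open>v\<close> fixed.\<close>
  have G: "G u v = 0" for u v
  proof (rule analytic_continuation[of "\<lambda>u. G u v" UNIV "UNIV - {0}" 0])
    show "(\<lambda>u. G u v) holomorphic_on UNIV"
      unfolding G_def by (intro hol holomorphic_intros) auto
    show "(0::complex) islimpt UNIV - {0}"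
      using islimpt_UNIV[of "0::complex"] islimpt_punctured[of 0 UNIV] by blast
  qed (auto simp: G_nz)
  show ?thesis
    using G[of "\<xi> - \<i> * \<eta>" "\<xi> + \<i> * \<eta>"] by (simp add: G_def)
qed

section \<open>Measures on the circle and their transforms along the spiral\<close>

theorem theorem2p8:
  "heisenberg_uniqueness_pair (sphere (0, 0) 1)
     {(exp t * cos t, exp t * sin t) | t :: real. t \<le> 0}"
  unfolding heisenberg_uniqueness_pair_def
proof (intro ballI impI)
  let ?S = "sphere (0 :: real, 0 :: real) 1"
  fix \<mu> :: "(real \<times> real) set \<Rightarrow> complex" and A :: "(real \<times> real) set"
  assume "\<mu> \<in> arc_length_ac_measures ?S"
    and spiral: "\<forall>p\<in>{(exp t * cos t, exp t * sin t) | t :: real. t \<le> 0}. fourier_transform \<mu> p = 0"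
    and A: "A \<in> sets borel"
  then have \<mu>: "complex_borel_measure \<mu>" "\<And>B. B \<in> sets borel \<Longrightarrow> B \<inter> ?S = {} \<Longrightarrow> \<mu> B = 0"
    by (auto simp: arc_length_ac_measures_def)
  have re: "signed_borel_measure (\<lambda>A. Re (\<mu> A))" and im: "signed_borel_measure (\<lambda>A. Im (\<mu> A))"
    using \<mu>(1) by (auto simp: signed_borel_measure_def complex_borel_measure_def intro!: sums_Re sums_Im)
  \<comment> \<open>The transform at complex frequencies, with the factor \<open>- \<i> * pi\<close>
    absorbed into \<open>a\<close> and \<open>b\<close>.\<close>
  define E where "E a b = complex_measure_integral \<mu> (\<lambda>(x, y). exp (a * of_real x + b * of_real y))"
    for a b
  have variation: "(\<lambda>z. \<integral>(x, y). exp (\<alpha> z * of_real x + \<beta> z * of_real y) \<partial>positive_variation \<nu>)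
      holomorphic_on UNIV"
    if "\<alpha> holomorphic_on UNIV" "\<beta> holomorphic_on UNIV" "signed_borel_measure \<nu>"
      "\<And>B. B \<in> sets borel \<Longrightarrow> B \<inter> ?S = {} \<Longrightarrow> \<nu> B = 0" for \<nu> \<alpha> \<beta>
  proof -
    interpret signed_borel_measure \<nu> by fact
    have "AE p in positive_variation \<nu>. p \<in> ?S"
      using that by (intro AE_positive_variation) auto
    then have "AE p in positive_variation \<nu>. norm p \<le> 1"
      by eventually_elim (simp add: dist_norm zero_prod_def[symmetric])
    then show ?thesis
      using that by (intro integral_exp_linear_holomorphic finite_measure_positive_variation) auto
  qed
  have E_hol: "(\<lambda>z. E (\<alpha> z) (\<beta> z)) holomorphic_on UNIV"
    if "\<alpha> holomorphic_on UNIV" "\<beta> holomorphic_on UNIV" for \<alpha> \<beta>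
    unfolding E_def complex_measure_integral_def
    using that \<mu>(2) re im re[THEN signed_borel_measure.uminus] im[THEN signed_borel_measure.uminus]
    by (intro holomorphic_intros variation) auto
  have E0: "E a b = 0" for a b
  proof -
    have "E (- \<i> * pi * \<xi>) (- \<i> * pi * \<eta>) = 0" for \<xi> \<eta>
    proof (rule vanishing_on_spiral[where E = "\<lambda>\<xi> \<eta>. E (- \<i> * pi * \<xi>) (- \<i> * pi * \<eta>)"])
      show "E (- \<i> * pi * of_real (exp t * cos t)) (- \<i> * pi * of_real (exp t * sin t)) = 0"
        if "t \<le> 0" for t :: real
      proof -
        have "fourier_transform \<mu> (exp t * cos t, exp t * sin t) = 0"
          using spiral that by blast
        then show ?thesis
          by (simp add: fourier_transform_def E_def algebra_simps)
      qed
    qed (intro E_hol holomorphic_intros)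
    \<comment> \<open>These frequencies undo the factor:
      \<open>- \<i> * pi * (\<i> * a / pi) = a\<close>.\<close>
    from this[of "\<i> * a / pi" "\<i> * b / pi"] show ?thesis
      by (simp flip: mult.assoc)
  qed
  have mgf: "(\<integral>x. exp (a \<bullet> x) \<partial>positive_variation (\<lambda>A. Re (\<mu> A))) =
        (\<integral>x. exp (a \<bullet> x) \<partial>positive_variation (\<lambda>A. - Re (\<mu> A)))"
      "(\<integral>x. exp (a \<bullet> x) \<partial>positive_variation (\<lambda>A. Im (\<mu> A))) =
        (\<integral>x. exp (a \<bullet> x) \<partial>positive_variation (\<lambda>A. - Im (\<mu> A)))" for a :: "real \<times> real"
  proof -
    \<comment> \<open>At real \<open>a\<close> the integrand is real, so all four variation
      integrals are real; the real and imaginary parts of \<open>E = 0\<close> then give one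
      equation for \<open>Re \<mu>\<close> and one for \<open>Im \<mu>\<close>.\<close>
    have "(\<lambda>(x, y). exp (of_real (fst a) * of_real x + of_real (snd a) * of_real y)) =
        (\<lambda>p. complex_of_real (exp (a \<bullet> p)))"
      by (simp add: inner_prod_def fun_eq_iff flip: exp_of_real)
    then show "(\<integral>x. exp (a \<bullet> x) \<partial>positive_variation (\<lambda>A. Re (\<mu> A))) =
        (\<integral>x. exp (a \<bullet> x) \<partial>positive_variation (\<lambda>A. - Re (\<mu> A)))"
      "(\<integral>x. exp (a \<bullet> x) \<partial>positive_variation (\<lambda>A. Im (\<mu> A))) =
        (\<integral>x. exp (a \<bullet> x) \<partial>positive_variation (\<lambda>A. - Im (\<mu> A)))"
      using E0[of "of_real (fst a)" "of_real (snd a)"]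
      by (simp_all add: E_def complex_measure_integral_def complex_eq_iff)
  qed
  have "Re (\<mu> A) = 0"
    using \<mu>(2) by (intro signed_measure_eq_0_mgf[OF re _ _ mgf(1) A, of ?S]) auto
  moreover have "Im (\<mu> A) = 0"
    using \<mu>(2) by (intro signed_measure_eq_0_mgf[OF im _ _ mgf(2) A, of ?S]) auto
  ultimately show "\<mu> A = 0"
    by (simp add: complex_eq_iff)
qed

end
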